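(* Let $X$ be a set, $E$ a nonempty set of parameters, $N\ge 1$ an integer, and let $(X,\mathcal{T}_i,N,E)$ be a soft $N$-topological space over $X$ with soft topologies $\mathcal{T}_1,\dots,\mathcal{T}_N$. If $(X,\mathcal{T}_i,N,E)$ is an $N$-wise soft $T_1$-space (respectively an $N$-wise soft $T_2$-space), then the supremum soft topological space $\left(X,\bigvee_{i=1}^N\mathcal{T}_i,E\right)$ is a soft $T_1$-space (respectively a soft $T_2$-space).
   Context: A soft set over $X$ (with respect to the fixed nonempty parameter set $E$) is a pair $(F,E)$ where $F:E\to\mathcal{P}(X)$ is any map. The null soft set has $F(e)=\emptyset$ for all $e$; the absolute soft set has $F(e)=X$ for all $e$. Soft unions and soft intersections are defined parameterwise: the soft union of $\{(F_i,E)\}_{i\in I}$ is given by $e\mapsto\bigcup_i F_i(e)$ and the soft intersection of $(F,E)$ and $(G,E)$ by $e\mapsto F(e)\cap G(e)$. A soft topology on $X$ with respect to $E$ is a family $\mathcal{T}$ of soft sets over $X$ that contains the null and the absolute soft sets, and is closed under soft intersections of two members and under arbitrary soft unions; then $(X,\mathcal{T},E)$ is a soft topological space. A soft $N$-topological space $(X,\mathcal{T}_i,N,E)$ over $X$ is the set $X$ equipped with $N$ different soft topologies $\mathcal{T}_1,\dots,\mathcal{T}_N$ on $X$ with respect to the same $E$. A soft set is a soft $N$-open set if it belongs to $\mathcal{T}_j$ for some $j\in\{1,\dots,N\}$. The supremum soft topology $\bigvee_{i=1}^N\mathcal{T}_i$ is the smallest soft topology on $X$ containing the ordinary union $\bigcup_{i=1}^N\mathcal{T}_i$.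 For $x\in X$ and $\alpha\in E$, the soft point $(x_\alpha,E)$ is the soft set with value $\{x\}$ at $\alpha$ and $\emptyset$ at every other parameter. It soft belongs to $(F,E)$ iff $x\in F(\alpha)$. Soft points $(x_\alpha,E)$ and $(y_\beta,E)$ are distinct iff $x\ne y$ or $\alpha\ne\beta$. $(X,\mathcal{T},E)$ is a soft $T_1$-space if for all distinct soft points $(x_\alpha,E),(y_\beta,E)$ over $X$ (in either order) there is $(A,E)\in\mathcal{T}$ such that $(x_\alpha,E)$ soft belongs to $(A,E)$ and $(y_\beta,E)$ does not. It is a soft $T_2$-space if for all distinct soft points $(x_\alpha,E),(y_\beta,E)$ there are $(A,E),(B,E)\in\mathcal{T}$ such that $(x_\alpha,E)$ soft belongs to $(A,E)$, $(y_\beta,E)$ soft belongs to $(B,E)$, and the soft intersection of $(A,E)$ and $(B,E)$ is the null soft set. $(X,\mathcal{T}_i,N,E)$ is an $N$-wise soft $T_1$-space (resp. $N$-wise soft $T_2$-space) if the same condition holds with "member of $\mathcal{T}$" replaced by "soft $N$-open set" (for $T_2$, $(A,E)$ and $(B,E)$ may come from different $\mathcal{T}_j$). *)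

theory Defs
  imports "HOL-Library.FuncSet"
begin

text \<open>
  A soft set over \<open>X\<close> is a map from \<open>E\<close> to \<open>Pow X\<close>. Maps with domain \<open>E\<close> are represented by
  extensional functions, so that equality of soft sets is equality on \<open>E\<close>.
\<close>

definition soft_sets :: "'a set \<Rightarrow> 'e set \<Rightarrow> ('e \<Rightarrow> 'a set) set" where
  "soft_sets X E = (E \<rightarrow>\<^sub>E Pow X)"

definition null_soft :: "'e set \<Rightarrow> ('e \<Rightarrow> 'a set)" where
  "null_soft E = (\<lambda>e\<in>E. {})"

definition absolute_soft :: "'a set \<Rightarrow> 'e set \<Rightarrow> ('e \<Rightarrow> 'a set)" where
  "absolute_soft X E = (\<lambda>e\<in>E. X)"

definition soft_Union :: "'e set \<Rightarrow> ('e \<Rightarrow> 'a set) set \<Rightarrow> ('e \<Rightarrow> 'a set)" where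
  "soft_Union E \<F> = (\<lambda>e\<in>E. \<Union>F\<in>\<F>. F e)"

definition soft_Int :: "'e set \<Rightarrow> ('e \<Rightarrow> 'a set) \<Rightarrow> ('e \<Rightarrow> 'a set) \<Rightarrow> ('e \<Rightarrow> 'a set)" where
  "soft_Int E F G = (\<lambda>e\<in>E. F e \<inter> G e)"

definition soft_topology :: "'a set \<Rightarrow> 'e set \<Rightarrow> ('e \<Rightarrow> 'a set) set \<Rightarrow> bool" where
  "soft_topology X E \<T> \<longleftrightarrow>
     \<T> \<subseteq> soft_sets X E \<and>
     null_soft E \<in> \<T> \<and> absolute_soft X E \<in> \<T> \<and>
     (\<forall>F\<in>\<T>. \<forall>G\<in>\<T>. soft_Int E F G \<in> \<T>) \<and>
     (\<forall>\<F>. \<F> \<subseteq> \<T> \<longrightarrow> soft_Union E \<F> \<in> \<T>)"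

text \<open>The injectivity condition says that the \<open>N\<close> soft topologies are different from each other.\<close>

definition soft_N_topological_space ::
  "'a set \<Rightarrow> (nat \<Rightarrow> ('e \<Rightarrow> 'a set) set) \<Rightarrow> nat \<Rightarrow> 'e set \<Rightarrow> bool" where
  "soft_N_topological_space X \<T> N E \<longleftrightarrow>
     (\<forall>i\<in>{1..N}. soft_topology X E (\<T> i)) \<and> inj_on \<T> {1..N}"

definition soft_N_open_sets :: "(nat \<Rightarrow> ('e \<Rightarrow> 'a set) set) \<Rightarrow> nat \<Rightarrow> ('e \<Rightarrow> 'a set) set" where
  "soft_N_open_sets \<T> N = {F. \<exists>j\<in>{1..N}. F \<in> \<T> j}"

definition sup_soft_topology ::
  "'a set \<Rightarrow> (nat \<Rightarrow> ('e \<Rightarrow> 'a set) set) \<Rightarrow> nat \<Rightarrow> 'e set \<Rightarrow> ('e \<Rightarrow> 'a set) set" where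
  "sup_soft_topology X \<T> N E =
     (LEAST \<S>. soft_topology X E \<S> \<and> (\<Union>i\<in>{1..N}. \<T> i) \<subseteq> \<S>)"

definition soft_point :: "'e set \<Rightarrow> 'a \<Rightarrow> 'e \<Rightarrow> ('e \<Rightarrow> 'a set)" where
  "soft_point E x \<alpha> = (\<lambda>e\<in>E. if e = \<alpha> then {x} else {})"

definition soft_points :: "'a set \<Rightarrow> 'e set \<Rightarrow> ('e \<Rightarrow> 'a set) set" where
  "soft_points X E = {soft_point E x \<alpha> | x \<alpha>. x \<in> X \<and> \<alpha> \<in> E}"

definition soft_belongs :: "'e set \<Rightarrow> ('e \<Rightarrow> 'a set) \<Rightarrow> ('e \<Rightarrow> 'a set) \<Rightarrow> bool" where
  "soft_belongs E P F \<longleftrightarrow> (\<exists>x. \<exists>\<alpha>\<in>E. P = soft_point E x \<alpha> \<and> x \<in> F \<alpha>)"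

text \<open>
  The two separation conditions relative to a family \<open>\<O>\<close> of soft sets, which is a soft topology
  in one use and the family of soft \<open>N\<close>-open sets in the other.
\<close>

definition soft_T1_separated :: "'a set \<Rightarrow> 'e set \<Rightarrow> ('e \<Rightarrow> 'a set) set \<Rightarrow> bool" where
  "soft_T1_separated X E \<O> \<longleftrightarrow>
     (\<forall>P\<in>soft_points X E. \<forall>Q\<in>soft_points X E. P \<noteq> Q \<longrightarrow>
        (\<exists>A\<in>\<O>. soft_belongs E P A \<and> \<not> soft_belongs E Q A))"

definition soft_T2_separated :: "'a set \<Rightarrow> 'e set \<Rightarrow> ('e \<Rightarrow> 'a set) set \<Rightarrow> bool" where
  "soft_T2_separated X E \<O> \<longleftrightarrow>
     (\<forall>P\<in>soft_points X E. \<forall>Q\<in>soft_points X E. P \<noteq> Q \<longrightarrow>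
        (\<exists>A\<in>\<O>. \<exists>B\<in>\<O>. soft_belongs E P A \<and> soft_belongs E Q B \<and> soft_Int E A B = null_soft E))"

definition soft_T1_space :: "'a set \<Rightarrow> ('e \<Rightarrow> 'a set) set \<Rightarrow> 'e set \<Rightarrow> bool" where
  "soft_T1_space X \<T> E \<longleftrightarrow> soft_topology X E \<T> \<and> soft_T1_separated X E \<T>"

definition soft_T2_space :: "'a set \<Rightarrow> ('e \<Rightarrow> 'a set) set \<Rightarrow> 'e set \<Rightarrow> bool" where
  "soft_T2_space X \<T> E \<longleftrightarrow> soft_topology X E \<T> \<and> soft_T2_separated X E \<T>"

definition N_wise_soft_T1_space ::
  "'a set \<Rightarrow> (nat \<Rightarrow> ('e \<Rightarrow> 'a set) set) \<Rightarrow> nat \<Rightarrow> 'e set \<Rightarrow> bool" where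
  "N_wise_soft_T1_space X \<T> N E \<longleftrightarrow>
     soft_N_topological_space X \<T> N E \<and> soft_T1_separated X E (soft_N_open_sets \<T> N)"

definition N_wise_soft_T2_space ::
  "'a set \<Rightarrow> (nat \<Rightarrow> ('e \<Rightarrow> 'a set) set) \<Rightarrow> nat \<Rightarrow> 'e set \<Rightarrow> bool" where
  "N_wise_soft_T2_space X \<T> N E \<longleftrightarrow>
     soft_N_topological_space X \<T> N E \<and> soft_T2_separated X E (soft_N_open_sets \<T> N)"

text \<open>Soft points are soft sets; their distinctness and membership reduce to conditions on \<open>(x, \<alpha>)\<close>.\<close>

lemma soft_point_in_soft_sets:
  assumes "x \<in> X" "\<alpha> \<in> E"
  shows "soft_point E x \<alpha> \<in> soft_sets X E"
  using assms by (auto simp: soft_point_def soft_sets_def)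

lemma soft_point_eq_iff:
  assumes "\<alpha> \<in> E" "\<beta> \<in> E"
  shows "soft_point E x \<alpha> = soft_point E y \<beta> \<longleftrightarrow> x = y \<and> \<alpha> = \<beta>"
proof
  assume "soft_point E x \<alpha> = soft_point E y \<beta>"
  then have "soft_point E x \<alpha> \<alpha> = soft_point E y \<beta> \<alpha>" by simp
  then show "x = y \<and> \<alpha> = \<beta>"
    using assms by (simp add: soft_point_def split: if_splits)
qed simp

lemma soft_belongs_soft_point:
  assumes "\<alpha> \<in> E"
  shows "soft_belongs E (soft_point E x \<alpha>) F \<longleftrightarrow> x \<in> F \<alpha>"
  using assms by (auto simp: soft_belongs_def soft_point_eq_iff)

text \<open>The smallest soft topology in the definition of the supremum exists.\<close>

lemma soft_topology_soft_sets: "soft_topology X E (soft_sets X E)"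
  by (auto simp: soft_topology_def soft_sets_def null_soft_def absolute_soft_def soft_Int_def
      soft_Union_def PiE_iff subset_iff)

lemma soft_topology_Inter:
  assumes "\<C> \<noteq> {}" "\<And>\<S>. \<S> \<in> \<C> \<Longrightarrow> soft_topology X E \<S>"
  shows "soft_topology X E (\<Inter>\<C>)"
proof -
  have "\<Inter>\<C> \<subseteq> soft_sets X E"
    using assms unfolding soft_topology_def by blast
  moreover have "soft_Union E \<F> \<in> \<Inter>\<C>" if "\<F> \<subseteq> \<Inter>\<C>" for \<F>
    using that assms(2) by (simp add: soft_topology_def le_Inf_iff)
  ultimately show ?thesis
    using assms(2) by (simp add: soft_topology_def)
qed

lemma sup_soft_topology_eq_Inter:
  assumes "soft_N_topological_space X \<T> N E"
  shows "sup_soft_topology X \<T> N E =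
    \<Inter>{\<S>. soft_topology X E \<S> \<and> (\<Union>i\<in>{1..N}. \<T> i) \<subseteq> \<S>}" (is "_ = \<Inter>?C")
proof -
  have "soft_sets X E \<in> ?C"
    using assms soft_topology_soft_sets
    by (auto simp: soft_N_topological_space_def soft_topology_def)
  then have "soft_topology X E (\<Inter>?C)"
    by (intro soft_topology_Inter) auto
  then show ?thesis
    unfolding sup_soft_topology_def by (intro Least_equality) auto
qed

end

theory Submission
  imports Defs
begin

text \<open>
  Both separation axioms only ask that certain open soft sets exist, so a family that separates
  soft points keeps doing so when it is enlarged (\<open>soft_T1_separated_mono\<close>,
  \<open>soft_T2_separated_mono\<close>). Every soft \<open>N\<close>-open set is open in the supremum soft topology; hence
  the open sets that witness \<open>N\<close>-wise separation, even when they come from different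
  \<open>\<T> j\<close>, all lie in the single soft topology \<open>\<Or>\<T> i\<close>.
\<close>

lemma soft_T1_separated_mono:
  assumes "soft_T1_separated X E \<O>" "\<O> \<subseteq> \<O>'"
  shows "soft_T1_separated X E \<O>'"
  using assms unfolding soft_T1_separated_def by (meson subsetD)

lemma soft_T2_separated_mono:
  assumes "soft_T2_separated X E \<O>" "\<O> \<subseteq> \<O>'"
  shows "soft_T2_separated X E \<O>'"
  using assms unfolding soft_T2_separated_def by (meson subsetD)

text \<open>
  The family of all soft sets is a soft topology above every \<open>\<T> i\<close>, so the intersection that
  represents the supremum is over a nonempty family and is again a soft topology.
\<close>

lemma soft_topology_sup_soft_topology:
  assumes "soft_N_topological_space X \<T> N E"
  shows "soft_topology X E (sup_soft_topology X \<T> N E)"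
proof -
  have "soft_topology X E (soft_sets X E) \<and> (\<Union>i\<in>{1..N}. \<T> i) \<subseteq> soft_sets X E"
    using assms soft_topology_soft_sets
    by (auto simp: soft_N_topological_space_def soft_topology_def)
  then show ?thesis
    unfolding sup_soft_topology_eq_Inter[OF assms] by (intro soft_topology_Inter) blast+
qed

lemma soft_N_open_sets_subset_sup_soft_topology:
  assumes "soft_N_topological_space X \<T> N E"
  shows "soft_N_open_sets \<T> N \<subseteq> sup_soft_topology X \<T> N E"
  unfolding sup_soft_topology_eq_Inter[OF assms] soft_N_open_sets_def by blast

theorem proposition4p9:
  fixes X :: "'a set" and E :: "'e set" and N :: nat
    and \<T> :: "nat \<Rightarrow> ('e \<Rightarrow> 'a set) set"
  assumes "E \<noteq> {}" and "N \<ge> 1"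
    and "soft_N_topological_space X \<T> N E"
  shows "(N_wise_soft_T1_space X \<T> N E \<longrightarrow> soft_T1_space X (sup_soft_topology X \<T> N E) E) \<and>
         (N_wise_soft_T2_space X \<T> N E \<longrightarrow> soft_T2_space X (sup_soft_topology X \<T> N E) E)"
  using soft_topology_sup_soft_topology[OF assms(3)]
    soft_N_open_sets_subset_sup_soft_topology[OF assms(3)]
  unfolding N_wise_soft_T1_space_def N_wise_soft_T2_space_def soft_T1_space_def soft_T2_space_def
  by (blast intro: soft_T1_separated_mono soft_T2_separated_mono)

end
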